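(* The problem $\textsc{RotDist}$ many-one reduces in polynomial time to the problem $\textsc{RotDist}_R$. Here $\textsc{RotDist}$ is the problem: given two full binary trees $T_1,T_2$ with the same number $n$ of internal nodes and an integer $k$, decide whether $d(T_1,T_2)\le k$. And $\textsc{RotDist}_R$ is the problem: given two full binary trees $T_1,T_2$ with the same number of internal nodes and an integer $k$, decide whether $d_R(T_1,T_2)\le k$.
   Context: A full binary tree is a rooted ordered tree in which every node is either a leaf or an internal node with exactly two children (a left and a right child). A right rotation at an internal node $a$ whose left child $b$ is internal, where $C,D$ are the left and right subtrees of $b$ and $E$ is the right subtree of $a$, replaces the subtree rooted at $a$ by the tree with root $b$, left subtree $C$, and right child $a$ whose left and right subtrees are $D$ and $E$; a left rotation is the symmetric operation (and is the inverse of a right rotation). The rotation distance $d(T_1,T_2)$ between two full binary trees with the same number of internal nodes is the minimum number of rotations transforming $T_1$ into $T_2$. The rank of a node is defined inductively: a leaf has rank $0$; an internal node with children $v,w$ has rank $\mathrm{rank}(v)+1$ if $\mathrm{rank}(v)=\mathrm{rank}(w)$, and $\max\{\mathrm{rank}(v),\mathrm{rank}(w)\}$ otherwise. The rank of a tree is the rank of its root. For full binary trees $T_1,T_2$ with the same number of internal nodes, let $r=\max\{\mathrm{rank}(T_1),\mathrm{rank}(T_2)\}$; the rank-bounded rotation distance $d_R(T_1,T_2)$ is the minimum length of a sequence of rotations transforming $T_1$ into $T_2$ such that every intermediate tree in the sequence has rank at most $r$. *)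

theory Defs
  imports
    "HOL-Library.Tree"
    "HOL-Library.Extended_Nat"
    "HOL-Computational_Algebra.Polynomial"
begin

section \<open>Full binary trees, rotations and rank\<close>

text \<open>
  Full binary trees carry no labels: constructor \<open>Leaf\<close> is a leaf and \<open>Node\<close> an internal node, so
  \<open>size\<close> counts the internal nodes.
\<close>

type_synonym full_binary_tree = "unit tree"

abbreviation node :: "full_binary_tree \<Rightarrow> full_binary_tree \<Rightarrow> full_binary_tree" where
  "node l r \<equiv> Node l () r"

inductive rotation :: "full_binary_tree \<Rightarrow> full_binary_tree \<Rightarrow> bool" where
  right: "rotation (node (node C D) E) (node C (node D E))"
| left: "rotation (node C (node D E)) (node (node C D) E)"
| in_left: "rotation l l' \<Longrightarrow> rotation (node l r) (node l' r)"
| in_right: "rotation r r' \<Longrightarrow> rotation (node l r) (node l r')"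

fun rank :: "full_binary_tree \<Rightarrow> nat" where
  "rank Leaf = 0"
| "rank (Node v _ w) = (if rank v = rank w then rank v + 1 else max (rank v) (rank w))"

definition rotation_sequence ::
  "full_binary_tree \<Rightarrow> full_binary_tree \<Rightarrow> nat \<Rightarrow> (nat \<Rightarrow> full_binary_tree) \<Rightarrow> bool" where
  "rotation_sequence T1 T2 m S \<longleftrightarrow>
     S 0 = T1 \<and> S m = T2 \<and> (\<forall>i<m. rotation (S i) (S (Suc i)))"

text \<open>
  The distances are extended naturals, so that the minimum over an empty set of sequences is
  \<open>\<infinity>\<close> rather than an unspecified number.
\<close>

definition rotation_distance :: "full_binary_tree \<Rightarrow> full_binary_tree \<Rightarrow> enat" where
  "rotation_distance T1 T2 = Inf {enat m | m. \<exists>S. rotation_sequence T1 T2 m S}"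

definition rank_bounded_rotation_distance :: "full_binary_tree \<Rightarrow> full_binary_tree \<Rightarrow> enat" where
  "rank_bounded_rotation_distance T1 T2 =
     Inf {enat m | m. \<exists>S. rotation_sequence T1 T2 m S \<and>
                          (\<forall>i\<le>m. rank (S i) \<le> max (rank T1) (rank T2))}"


section \<open>Polynomial-time many-one reductions\<close>

text \<open>
  Deterministic multi-tape Turing machines. Tapes are infinite in both directions; the symbols are
  the numbers below \<open>symbols M\<close>, with \<open>0\<close> as blank and \<open>1\<close>, \<open>2\<close> for the two bits. The machine starts
  in state \<open>0\<close>; its proper states are the numbers below \<open>states M\<close>, and it halts on reaching the
  state \<open>states M\<close>.
\<close>

datatype move = Move_Left | Stay | Move_Right

record turing_machine =
  tapes :: nat
  states :: nat
  symbols :: nat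
  transition :: "nat \<Rightarrow> nat list \<Rightarrow> nat \<times> (nat \<times> move) list"

definition wf_turing_machine :: "turing_machine \<Rightarrow> bool" where
  "wf_turing_machine M \<longleftrightarrow>
     tapes M \<ge> 1 \<and> symbols M \<ge> 3 \<and>
     (\<forall>q < states M. \<forall>rs. length rs = tapes M \<and> (\<forall>s \<in> set rs. s < symbols M) \<longrightarrow>
        (case transition M q rs of (q', acts) \<Rightarrow>
           q' \<le> states M \<and> length acts = tapes M \<and> (\<forall>(s, d) \<in> set acts. s < symbols M)))"

type_synonym tape = "(int \<Rightarrow> nat) \<times> int"

type_synonym configuration = "nat \<times> tape list"

definition read :: "tape \<Rightarrow> nat" where
  "read tp = (case tp of (c, h) \<Rightarrow> c h)"

fun head_offset :: "move \<Rightarrow> int" where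
  "head_offset Move_Left = -1"
| "head_offset Stay = 0"
| "head_offset Move_Right = 1"

definition act :: "nat \<times> move \<Rightarrow> tape \<Rightarrow> tape" where
  "act a tp = (case a of (s, d) \<Rightarrow> case tp of (c, h) \<Rightarrow> (c(h := s), h + head_offset d))"

definition step :: "turing_machine \<Rightarrow> configuration \<Rightarrow> configuration" where
  "step M cfg = (case cfg of (q, tps) \<Rightarrow>
     if q < states M
     then (case transition M q (map read tps) of (q', acts) \<Rightarrow> (q', map2 act acts tps))
     else cfg)"

definition bit_symbol :: "bool \<Rightarrow> nat" where
  "bit_symbol b = (if b then 2 else 1)"

definition word_contents :: "bool list \<Rightarrow> int \<Rightarrow> nat" where
  "word_contents w i =
     (if 0 \<le> i \<and> i < int (length w) then bit_symbol (w ! nat i) else 0)"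

definition initial_configuration :: "turing_machine \<Rightarrow> bool list \<Rightarrow> configuration" where
  "initial_configuration M w =
     (0, (word_contents w, 0) # replicate (tapes M - 1) (word_contents [], 0))"

text \<open>
  The input is on the first tape, the output on the last one, whose head may be anywhere.
\<close>

definition halts_with_output :: "turing_machine \<Rightarrow> configuration \<Rightarrow> bool list \<Rightarrow> bool" where
  "halts_with_output M cfg w \<longleftrightarrow>
     fst cfg = states M \<and> fst (last (snd cfg)) = word_contents w"

definition polynomial_time_computable :: "(bool list \<Rightarrow> bool list) \<Rightarrow> bool" where
  "polynomial_time_computable f \<longleftrightarrow>
     (\<exists>M (p :: nat poly). wf_turing_machine M \<and>
        (\<forall>w. \<exists>t \<le> poly p (length w).
           halts_with_output M ((step M ^^ t) (initial_configuration M w)) (f w)))"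

definition polynomial_time_many_one_reducible :: "bool list set \<Rightarrow> bool list set \<Rightarrow> bool" where
  "polynomial_time_many_one_reducible A B \<longleftrightarrow>
     (\<exists>f. polynomial_time_computable f \<and> (\<forall>w. w \<in> A \<longleftrightarrow> f w \<in> B))"


section \<open>The decision problems\<close>

text \<open>
  An instance is a bit string: both trees in preorder, followed by a sign bit and the binary
  digits of \<open>\<bar>k\<bar>\<close>, least significant first and without leading zeros.
\<close>

fun encode_tree :: "full_binary_tree \<Rightarrow> bool list" where
  "encode_tree Leaf = [False]"
| "encode_tree (Node l _ r) = True # encode_tree l @ encode_tree r"

fun encode_nat :: "nat \<Rightarrow> bool list" where
  "encode_nat n = (if n = 0 then [] else odd n # encode_nat (n div 2))"

declare encode_nat.simps [simp del]

definition encode_int :: "int \<Rightarrow> bool list" where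
  "encode_int k = (k < 0) # encode_nat (nat \<bar>k\<bar>)"

definition encode_instance :: "full_binary_tree \<Rightarrow> full_binary_tree \<Rightarrow> int \<Rightarrow> bool list" where
  "encode_instance T1 T2 k = encode_tree T1 @ encode_tree T2 @ encode_int k"

lemma encode_tree_append_inject:
  "encode_tree S @ u = encode_tree T @ v \<longleftrightarrow> S = T \<and> u = v"
proof (induction S arbitrary: T u v)
  case Leaf
  then show ?case by (cases T) auto
next
  case (Node l x r)
  then show ?case by (cases T) auto
qed

lemma encode_nat_inject: "encode_nat m = encode_nat n \<longleftrightarrow> m = n"
proof (induction m arbitrary: n rule: less_induct)
  case (less m)
  show ?case
  proof (cases "m = 0 \<or> n = 0")
    case True
    then show ?thesis by (auto simp: encode_nat.simps[of m] encode_nat.simps[of n])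
  next
    case False
    have "(odd m \<longleftrightarrow> odd n) \<and> m div 2 = n div 2 \<longleftrightarrow> m = n"
      by presburger
    then show ?thesis
      using False less.IH[of "m div 2" "n div 2"]
      by (simp add: encode_nat.simps[of m] encode_nat.simps[of n])
  qed
qed

lemma encode_instance_inject:
  "encode_instance T1 T2 k = encode_instance T1' T2' k' \<longleftrightarrow> T1 = T1' \<and> T2 = T2' \<and> k = k'"
  by (auto simp: encode_instance_def encode_int_def encode_tree_append_inject encode_nat_inject)

text \<open>
  Distances are nonnegative, so for an integer \<open>k\<close> the two last conjuncts below say that the
  distance is at most \<open>k\<close>; bit strings that encode no instance belong to neither language.
\<close>

definition RotDist :: "bool list set" where
  "RotDist = {encode_instance T1 T2 k | T1 T2 k.
     size T1 = size T2 \<and> 0 \<le> k \<and> rotation_distance T1 T2 \<le> enat (nat k)}"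

definition RotDist\<^sub>R :: "bool list set" where
  "RotDist\<^sub>R = {encode_instance T1 T2 k | T1 T2 k.
     size T1 = size T2 \<and> 0 \<le> k \<and> rank_bounded_rotation_distance T1 T2 \<le> enat (nat k)}"

end

theory Submission
  imports Defs
begin

text \<open>
  Let \<open>B\<close> be a perfect tree of height \<open>h\<close> with \<open>2 ^ h \<ge> 2 * (n + 1)\<close>. Every tree with \<open>n\<close> internal
  nodes has rank less than \<open>h\<close>, so in a rotation sequence confined to the right subtree of
  \<open>node B T\<^sub>1\<close> all trees have rank \<open>h\<close>. Conversely, deleting the leaves of \<open>B\<close> turns each rotation
  into a rotation or the identity, so that sequences from \<open>node B T\<^sub>1\<close> to \<open>node B T\<^sub>2\<close>
  project to sequences from \<open>T\<^sub>1\<close> to \<open>T\<^sub>2\<close> that are no longer. Hence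
  \<open>d\<^sub>R (node B T\<^sub>1) (node B T\<^sub>2) = d T\<^sub>1 T\<^sub>2\<close>.

  A three-tape machine computes the reduction in linear time. Its second tape is the stack of a
  depth-first traversal of a perfect tree: a stretch of \<open>h\<close> cells that record which child is being
  visited. Traversals of heights \<open>1, 2, \<dots>\<close>, in which every leaf consumes one input symbol, determine a
  height \<open>h\<close> proportional to the logarithm of the input length; the same traversal then writes \<open>B\<close>.
\<close>

section \<open>Perfect trees as a padding\<close>

fun perfect :: "nat \<Rightarrow> full_binary_tree" where
  "perfect 0 = Leaf"
| "perfect (Suc h) = node (perfect h) (perfect h)"

lemma rank_perfect [simp]: "rank (perfect h) = h"
  by (induction h) auto

text \<open>Two children of equal rank contribute equally large bounds, whose sum doubles; otherwise
  the child of larger rank alone has enough leaves. This turns a bound on size into a bound on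
  rank.\<close>

lemma power_rank_le_size1: "2 ^ rank t \<le> size1 t"
proof (induction t)
  case (Node l x r)
  have "2 ^ rank l + 2 ^ rank r \<le> size1 l + size1 r"
    using Node.IH by (rule add_mono)
  then show ?case
    using Node.IH by (auto simp: max_def)
qed simp

lemma rotation_size: "rotation s t \<Longrightarrow> size s = size t"
  by (induction rule: rotation.induct) auto

lemma rotation_sequence_size:
  assumes "rotation_sequence s t m S" and "i \<le> m"
  shows "size (S i) = size s"
  using assms(2)
proof (induction i)
  case 0
  then show ?case using assms(1) by (simp add: rotation_sequence_def)
next
  case (Suc i)
  then have "rotation (S i) (S (Suc i))"
    using assms(1) by (simp add: rotation_sequence_def)
  with Suc show ?case by (simp add: rotation_size)
qed

section \<open>Deletion of leaves under rotations\<close>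

fun delete_first_leaf :: "full_binary_tree \<Rightarrow> full_binary_tree" where
  "delete_first_leaf Leaf = Leaf"
| "delete_first_leaf (Node Leaf _ r) = r"
| "delete_first_leaf (Node l _ r) = node (delete_first_leaf l) r"

lemma delete_first_leaf_Node:
  "l \<noteq> Leaf \<Longrightarrow> delete_first_leaf (Node l x r) = node (delete_first_leaf l) r"
  by (cases l) auto

text \<open>Deletion contracts the leftmost leaf together with its parent. At the rotated node it
  stays inside \<open>C\<close> unless \<open>C\<close> is \<open>Leaf\<close>; then both sides
  contract to \<open>node D E\<close> and the rotation disappears.\<close>

lemma rotation_delete_first_leaf:
  "rotation s t \<Longrightarrow>
    delete_first_leaf s = delete_first_leaf t \<or> rotation (delete_first_leaf s) (delete_first_leaf t)"
proof (induction rule: rotation.induct)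
  case (right C D E)
  then show ?case
    by (cases "C = Leaf") (auto simp: delete_first_leaf_Node intro: rotation.intros)
next
  case (left C D E)
  then show ?case
    by (cases "C = Leaf") (auto simp: delete_first_leaf_Node intro: rotation.intros)
next
  case (in_left l l' r)
  then have "l \<noteq> Leaf" "l' \<noteq> Leaf" by (auto elim: rotation.cases)
  with in_left show ?case by (auto simp: delete_first_leaf_Node intro: rotation.intros)
next
  case (in_right r r' l)
  then show ?case
    by (cases "l = Leaf") (auto simp: delete_first_leaf_Node intro: rotation.intros)
qed

lemma rotation_funpow_delete_first_leaf:
  assumes "rotation s t"
  shows "(delete_first_leaf ^^ k) s = (delete_first_leaf ^^ k) t \<or>
    rotation ((delete_first_leaf ^^ k) s) ((delete_first_leaf ^^ k) t)"
proof (induction k)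
  case (Suc k)
  then show ?case using rotation_delete_first_leaf by auto
qed (simp add: assms)

lemma size_delete_first_leaf: "t \<noteq> Leaf \<Longrightarrow> Suc (size (delete_first_leaf t)) = size t"
  by (induction t rule: delete_first_leaf.induct) auto

text \<open>After \<open>size l\<close> deletions a single leaf is left of \<open>l\<close>; one
  more removes it together with the root.\<close>

lemma funpow_delete_first_leaf_node:
  "(delete_first_leaf ^^ size1 l) (node l r) = r"
proof (induction "size l" arbitrary: l)
  case 0
  then show ?case by simp
next
  case (Suc n)
  then have "l \<noteq> Leaf" by auto
  then have "size1 l = Suc (size1 (delete_first_leaf l))" "n = size (delete_first_leaf l)"
    using Suc.hyps(2) size_delete_first_leaf[of l] by (simp_all add: size1_size)
  with Suc.hyps(1) \<open>l \<noteq> Leaf\<close> show ?case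
    by (simp add: funpow_Suc_right delete_first_leaf_Node del: funpow.simps)
qed

lemma rotation_sequence_compress:
  assumes "\<forall>i<m. S i = S (Suc i) \<or> rotation (S i) (S (Suc i))"
  shows "\<exists>k\<le>m. \<exists>S'. rotation_sequence (S 0) (S m) k S'"
  using assms
proof (induction m)
  case 0
  then show ?case by (auto simp: rotation_sequence_def)
next
  case (Suc m)
  then obtain k S' where k: "k \<le> m" "rotation_sequence (S 0) (S m) k S'" by auto
  consider "S m = S (Suc m)" | "rotation (S m) (S (Suc m))"
    using Suc.prems by auto
  then show ?case
  proof cases
    case 1
    then show ?thesis using k by (metis le_Suc_eq)
  next
    case 2
    then have "rotation_sequence (S 0) (S (Suc m)) (Suc k) (S'(Suc k := S (Suc m)))"
      using k(2) by (auto simp: rotation_sequence_def less_Suc_eq)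
    then show ?thesis using k(1) by blast
  qed
qed

lemma rank_bounded_rotation_distance_node_perfect:
  assumes "size s = size t" and h: "2 * size1 s \<le> 2 ^ h"
  shows "rank_bounded_rotation_distance (node (perfect h) s) (node (perfect h) t) =
    rotation_distance s t"
proof (rule antisym)
  have rank: "rank (node (perfect h) u) = h" if "size u = size s" for u
  proof -
    \<comment> \<open>The factor \<open>2\<close> in the hypothesis makes the rank of
      \<open>u\<close> strictly smaller than \<open>h\<close>; equality would raise the rank of the
      padded tree to \<open>h + 1\<close>.\<close>
    have "(2::nat) ^ Suc (rank u) \<le> 2 ^ h"
      using power_rank_le_size1[of u] that h by (simp add: size1_size)
    then have "rank u < h"
      by (metis Suc_le_eq one_less_numeral_iff power_le_imp_le_exp semiring_norm(76))
    then show ?thesis by simp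
  qed
  show "rank_bounded_rotation_distance (node (perfect h) s) (node (perfect h) t)
    \<le> rotation_distance s t"
    unfolding rank_bounded_rotation_distance_def rotation_distance_def
  proof (rule Inf_superset_mono, clarify)
    fix m S assume S: "rotation_sequence s t m S"
    then have "rotation_sequence (node (perfect h) s) (node (perfect h) t) m (\<lambda>i. node (perfect h) (S i))"
      by (auto simp: rotation_sequence_def intro: rotation.intros)
    moreover have "rank (node (perfect h) (S i)) = h" if "i \<le> m" for i
      using rotation_sequence_size[OF S that] rank by blast
    ultimately show "\<exists>m'. enat m = enat m' \<and>
      (\<exists>S. rotation_sequence (node (perfect h) s) (node (perfect h) t) m' S \<and>
        (\<forall>i\<le>m'. rank (S i) \<le> max (rank (node (perfect h) s)) (rank (node (perfect h) t))))"
      using rank[of s] by (intro exI[of _ m] conjI refl exI[of _ "\<lambda>i. node (perfect h) (S i)"]) auto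
  qed
  \<comment> \<open>The number of deletions is the same for every tree of the sequence, so the
    projection also applies where rotations have broken up the perfect subtree.\<close>
  let ?f = "delete_first_leaf ^^ size1 (perfect h)"
  show "rotation_distance s t \<le>
    rank_bounded_rotation_distance (node (perfect h) s) (node (perfect h) t)"
    unfolding rank_bounded_rotation_distance_def
  proof (rule Inf_greatest, clarify)
    fix m S assume S: "rotation_sequence (node (perfect h) s) (node (perfect h) t) m S"
    have "\<forall>i<m. ?f (S i) = ?f (S (Suc i)) \<or> rotation (?f (S i)) (?f (S (Suc i)))"
      using S rotation_funpow_delete_first_leaf by (simp add: rotation_sequence_def)
    from rotation_sequence_compress[of m "\<lambda>i. ?f (S i)", OF this]
    obtain k S' where "k \<le> m" "rotation_sequence (?f (S 0)) (?f (S m)) k S'" by blast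
    moreover have "?f (S 0) = s" "?f (S m) = t"
      using S by (simp_all add: rotation_sequence_def funpow_delete_first_leaf_node del: size1_size)
    ultimately show "rotation_distance s t \<le> enat m"
      unfolding rotation_distance_def
      by (intro Inf_lower2[of "enat k"]) auto
  qed
qed


section \<open>The reduction\<close>

text \<open>
  \<open>split_trees c u\<close> splits off the encodings of \<open>c + 1\<close> trees.
\<close>

fun split_trees :: "nat \<Rightarrow> bool list \<Rightarrow> (bool list \<times> bool list) option" where
  "split_trees c [] = None"
| "split_trees c (True # u) = map_option (apfst (Cons True)) (split_trees (Suc c) u)"
| "split_trees 0 (False # u) = Some ([False], u)"
| "split_trees (Suc c) (False # u) = map_option (apfst (Cons False)) (split_trees c u)"

text \<open>With \<open>c + 1\<close> trees still expected, \<open>True\<close> replaces one of them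
  by two and \<open>False\<close> completes one, so a whole tree code lowers the count by exactly
  one.\<close>

lemma split_trees_encode_tree_append:
  "split_trees c (encode_tree t @ u) =
    (case c of 0 \<Rightarrow> Some (encode_tree t, u)
     | Suc c' \<Rightarrow> map_option (apfst ((@) (encode_tree t))) (split_trees c' u))"
proof (induction t arbitrary: c u)
  case Leaf
  show ?case by (cases c) (auto intro!: arg_cong2[where f = map_option])
next
  case (Node l x r)
  show ?case
    by (cases c) (auto simp: Node.IH option.map_comp comp_def apfst_def map_prod_def case_prod_unfold)
qed

text \<open>Soundness on arbitrary words, needed because the input may encode no instance. After
  \<open>True\<close>, the first two trees of the recursive result become the children of one
  node.\<close>

lemma split_trees_SomeD:
  "split_trees c u = Some (y, v) \<Longrightarrow>
    \<exists>ts. length ts = Suc c \<and> y = concat (map encode_tree ts) \<and> u = y @ v"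
proof (induction c u arbitrary: y v rule: split_trees.induct)
  case (2 c u)
  then obtain y' where y': "y = True # y'" "split_trees (Suc c) u = Some (y', v)"
    by auto
  with 2 obtain ts where ts: "length ts = Suc (Suc c)" "y' = concat (map encode_tree ts)" "u = y' @ v"
    by blast
  then obtain l r ts' where "ts = l # r # ts'"
    by (auto simp: length_Suc_conv)
  with ts y' show ?case by (intro exI[of _ "node l r # ts'"]) auto
next
  case (3 u)
  then show ?case by (intro exI[of _ "[Leaf]"]) auto
next
  case (4 c u)
  then obtain y' where y': "y = False # y'" "split_trees c u = Some (y', v)"
    by auto
  with 4 obtain ts where "length ts = Suc c" "y' = concat (map encode_tree ts)" "u = y' @ v"
    by blast
  with y' show ?case by (intro exI[of _ "Leaf # ts"]) auto
qed simp

text \<open>Perfect trees of heights \<open>1\<close> to \<open>h\<close> have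
  \<open>2 ^ Suc h - 2\<close> leaves in total, so this is the first height at which the counting
  traversals exhaust \<open>m\<close> input symbols.\<close>

definition padding_height :: "nat \<Rightarrow> nat" where
  "padding_height m = (LEAST h. m + 2 \<le> 2 ^ Suc h)"

lemma padding_height: "m + 2 \<le> 2 ^ Suc (padding_height m)"
  unfolding padding_height_def
proof (rule LeastI[of _ m])
  show "m + 2 \<le> 2 ^ Suc m" by (induction m) auto
qed

lemma less_padding_height: "h < padding_height m \<Longrightarrow> 2 ^ Suc h < m + 2"
  unfolding padding_height_def using not_less_Least[of h] by fastforce

text \<open>Minimality of the height keeps the padding, and hence the running time, linear in
  \<open>m\<close>.\<close>

lemma power_padding_height_le: "2 ^ padding_height m \<le> m + 1"
proof (cases "padding_height m")
  case (Suc h)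
  then show ?thesis using less_padding_height[of h m] by simp
qed simp

text \<open>The leading \<open>True\<close> is the root of the padded tree; its right subtree is
  supplied by the input that is copied next.\<close>

definition padding :: "nat \<Rightarrow> bool list" where
  "padding m = True # encode_tree (perfect (padding_height m))"

definition reduction :: "bool list \<Rightarrow> bool list" where
  "reduction w = padding (length w) @
     (case split_trees 0 w of None \<Rightarrow> w | Some (y, u) \<Rightarrow> y @ padding (length w) @ u)"

lemma length_encode_tree: "length (encode_tree t) = 2 * size t + 1"
  by (induction t) auto

lemma reduction_encode_instance:
  fixes T1 T2 :: full_binary_tree and k :: int
  defines "B \<equiv> perfect (padding_height (length (encode_instance T1 T2 k)))"
  shows "reduction (encode_instance T1 T2 k) = encode_instance (node B T1) (node B T2) k"
  by (simp add: reduction_def encode_instance_def padding_def split_trees_encode_tree_append B_def)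

text \<open>Words that encode no instance must not be mapped to instances. Tree codes are
  prefix-free, so the padding can be stripped from the output and the original instance
  recovered.\<close>

lemma reduction_eq_encode_instanceD:
  assumes "reduction w = encode_instance S1 S2 k"
  obtains T1 T2 where "w = encode_instance T1 T2 k"
    and "S1 = node (perfect (padding_height (length w))) T1"
    and "S2 = node (perfect (padding_height (length w))) T2"
proof (cases "split_trees 0 w")
  case None
  then have *: "True # encode_tree (perfect (padding_height (length w))) @ w =
      encode_tree S1 @ encode_tree S2 @ encode_int k"
    using assms by (simp add: reduction_def padding_def encode_instance_def)
  then obtain l r where "S1 = node l r" by (cases S1) auto
  \<comment> \<open>Now \<open>w\<close> starts with a tree code, which contradicts the failed
    split.\<close>
  with * have "w = encode_tree r @ encode_tree S2 @ encode_int k"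
    by (simp add: encode_tree_append_inject)
  with None show ?thesis by (simp add: split_trees_encode_tree_append)
next
  case (Some p)
  then obtain y u where p: "split_trees 0 w = Some (y, u)" by (cases p) auto
  then obtain T1 where y: "y = encode_tree T1" and w: "w = y @ u"
    using split_trees_SomeD[OF p] by (auto simp: length_Suc_conv)
  let ?B = "perfect (padding_height (length w))"
  have "encode_tree (node ?B T1) @ True # encode_tree ?B @ u =
      encode_tree S1 @ encode_tree S2 @ encode_int k"
    using assms p by (simp add: reduction_def padding_def encode_instance_def y)
  then have S1: "S1 = node ?B T1"
    and *: "True # encode_tree ?B @ u = encode_tree S2 @ encode_int k"
    by (simp_all only: encode_tree_append_inject)
  from * obtain l r where "S2 = node l r" by (cases S2) auto
  with * have "S2 = node ?B r" "u = encode_tree r @ encode_int k"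
    by (simp_all add: encode_tree_append_inject)
  with S1 w y show ?thesis by (intro that[of T1 r]) (auto simp: encode_instance_def)
qed

lemma rank_bounded_rotation_distance_padding:
  fixes T1 T2 :: full_binary_tree and k :: int
  defines "B \<equiv> perfect (padding_height (length (encode_instance T1 T2 k)))"
  assumes "size T1 = size T2"
  shows "rank_bounded_rotation_distance (node B T1) (node B T2) = rotation_distance T1 T2"
  unfolding B_def
proof (rule rank_bounded_rotation_distance_node_perfect[OF assms(2)])
  \<comment> \<open>Two tree codes of length \<open>2 * n + 1\<close> and the sign bit give at least
    \<open>4 * n + 3\<close> symbols, where \<open>n\<close> is \<open>size T1\<close>.\<close>
  have "4 * size1 T1 \<le> length (encode_instance T1 T2 k) + 2"
    using assms(2) by (simp add: encode_instance_def length_encode_tree encode_int_def size1_size)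
  also have "\<dots> \<le> 2 ^ Suc (padding_height (length (encode_instance T1 T2 k)))"
    by (rule padding_height)
  finally show "2 * size1 T1 \<le> 2 ^ padding_height (length (encode_instance T1 T2 k))"
    by simp
qed

lemma reduction_correct: "w \<in> RotDist \<longleftrightarrow> reduction w \<in> RotDist\<^sub>R"
proof
  assume "w \<in> RotDist"
  then show "reduction w \<in> RotDist\<^sub>R"
    by (force simp: RotDist_def RotDist\<^sub>R_def reduction_encode_instance
        rank_bounded_rotation_distance_padding)
next
  assume "reduction w \<in> RotDist\<^sub>R"
  then obtain S1 S2 k where S: "reduction w = encode_instance S1 S2 k" "size S1 = size S2" "0 \<le> k"
    "rank_bounded_rotation_distance S1 S2 \<le> enat (nat k)"
    by (auto simp: RotDist\<^sub>R_def)
  from reduction_eq_encode_instanceD[OF S(1)] obtain T1 T2 where T: "w = encode_instance T1 T2 k"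
    "S1 = node (perfect (padding_height (length w))) T1"
    "S2 = node (perfect (padding_height (length w))) T2" .
  have "size T1 = size T2" using T(2,3) S(2) by simp
  with rank_bounded_rotation_distance_padding[of T1 T2 k] S(3,4) T
  show "w \<in> RotDist" by (auto simp: RotDist_def)
qed


section \<open>A Turing machine for the reduction\<close>

text \<open>
  On the stack tape, symbol \<open>1\<close> marks a node whose left subtree is being traversed, symbol \<open>2\<close> one
  whose right subtree is being traversed. States \<open>1\<close> and \<open>0\<close> descend and ascend in the counting
  traversals, states \<open>4, 5\<close> and \<open>8, 9\<close> in the two writing ones. State \<open>2\<close> rewinds the input, state \<open>6\<close>
  copies the first tree, with the distance of the stack head from the bottom of the stack
  as the counter \<open>c\<close> of \<open>split_trees c\<close>, and state \<open>10\<close> copies the rest.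
\<close>

definition reduction_transition :: "nat \<Rightarrow> nat list \<Rightarrow> nat \<times> (nat \<times> move) list" where
  "reduction_transition q rs = (let a = rs ! 0; c = rs ! 1; b = rs ! 2 in
     if q = 0 then
       if c = 2 then (0, [(a, Stay), (1, Move_Left), (b, Stay)])
       else if c = 1 then (1, [(a, Stay), (2, Move_Right), (b, Stay)])
       else if a \<noteq> 0 then (1, [(a, Stay), (1, Stay), (b, Stay)])
       else (2, [(a, Move_Left), (c, Move_Right), (b, Stay)])
     else if q = 1 then
       if c = 0 then (0, [(a, if a = 0 then Stay else Move_Right), (c, Move_Left), (b, Stay)])
       else (1, [(a, Stay), (c, Move_Right), (b, Stay)])
     else if q = 2 then
       if a = 0 then (3, [(a, Move_Right), (c, Stay), (b, Stay)])
       else (2, [(a, Move_Left), (c, Stay), (b, Stay)])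
     else if q = 3 \<or> q = 7 then (q + 1, [(a, Stay), (c, Stay), (2, Move_Right)])
     else if q = 4 \<or> q = 8 then
       if c = 0 then (q + 1, [(a, Stay), (c, Move_Left), (1, Move_Right)])
       else (q, [(a, Stay), (c, Move_Right), (2, Move_Right)])
     else if q = 5 \<or> q = 9 then
       if c = 2 then (q, [(a, Stay), (1, Move_Left), (b, Stay)])
       else if c = 1 then (q - 1, [(a, Stay), (2, Move_Right), (b, Stay)])
       else (q + 1, [(a, Stay), (c, Move_Right), (b, Stay)])
     else if q = 6 then
       if a = 0 then (11, [(a, Stay), (c, Stay), (b, Stay)])
       else if a = 2 then (6, [(a, Move_Right), (c, Move_Left), (a, Move_Right)])
       else if c = 0 then (6, [(a, Move_Right), (c, Move_Right), (a, Move_Right)])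
       else (7, [(a, Move_Right), (c, Stay), (a, Move_Right)])
     else
       if a = 0 then (11, [(a, Stay), (c, Stay), (b, Stay)])
       else (10, [(a, Move_Right), (c, Stay), (a, Move_Right)]))"

definition reduction_machine :: turing_machine where
  "reduction_machine = \<lparr>tapes = 3, states = 11, symbols = 3, transition = reduction_transition\<rparr>"

lemma reduction_machine_simps [simp]:
  "tapes reduction_machine = 3" "states reduction_machine = 11" "symbols reduction_machine = 3"
  "transition reduction_machine = reduction_transition"
  by (simp_all add: reduction_machine_def)

lemma wf_reduction_machine: "wf_turing_machine reduction_machine"
proof -
  have "case reduction_transition q rs of (q', acts) \<Rightarrow>
      q' \<le> 11 \<and> length acts = 3 \<and> (\<forall>(s, d) \<in> set acts. s < 3)"
    if "q < 11" and "length rs = 3" and "\<forall>s \<in> set rs. s < 3" for q rs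
  proof -
    have "rs ! 0 < 3" "rs ! 1 < 3" "rs ! 2 < 3"
      using that(2,3) by simp_all
    then show ?thesis
      using that(1) by (auto simp: reduction_transition_def Let_def)
  qed
  then show ?thesis by (simp add: wf_turing_machine_def)
qed

section \<open>Runs of bounded length\<close>

definition reaches :: "configuration \<Rightarrow> nat \<Rightarrow> configuration \<Rightarrow> bool" where
  "reaches x n y \<longleftrightarrow> (\<exists>t\<le>n. (step reduction_machine ^^ t) x = y)"

lemma reaches_refl: "reaches x n x"
  unfolding reaches_def by (intro exI[of _ 0]) simp

lemma reaches_trans:
  assumes "reaches x m y" "reaches y n z"
  shows "reaches x (m + n) z"
proof -
  obtain s t where "s \<le> m" "t \<le> n" "(step reduction_machine ^^ s) x = y"
    "(step reduction_machine ^^ t) y = z"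
    using assms by (auto simp: reaches_def)
  then show ?thesis
    unfolding reaches_def by (intro exI[of _ "t + s"]) (simp add: funpow_add)
qed

lemma reaches_step: "reaches (step reduction_machine x) n z \<Longrightarrow> reaches x (Suc n) z"
  unfolding reaches_def by (metis Suc_le_mono comp_apply funpow_Suc_right)

lemma reaches_mono: "reaches x m y \<Longrightarrow> m \<le> n \<Longrightarrow> reaches x n y"
  unfolding reaches_def using order_trans by blast

lemma step_reduction_machine:
  "step reduction_machine (q, [(f, i), (g, j), (u, k)]) =
    (if q < 11 then case reduction_transition q [f i, g j, u k] of (q', acts) \<Rightarrow>
       (q', map2 act acts [(f, i), (g, j), (u, k)])
     else (q, [(f, i), (g, j), (u, k)]))"
  by (simp add: step_def read_def)

lemma bit_symbol_simps [simp]: "bit_symbol True = 2" "bit_symbol False = 1" "bit_symbol b \<noteq> 0" "bit_symbol b > 0"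
  by (simp_all add: bit_symbol_def)

lemma word_contents_end [simp]: "word_contents w (int (length w)) = 0"
  by (simp add: word_contents_def)

lemma word_contents_neg [simp]: "i < 0 \<Longrightarrow> word_contents w i = 0"
  by (simp add: word_contents_def)

lemma word_contents_nth: "i < length w \<Longrightarrow> word_contents w (int i) = bit_symbol (w ! i)"
  by (simp add: word_contents_def)

lemma word_contents_snoc [simp]:
  "(word_contents w)(int (length w) := bit_symbol b) = word_contents (w @ [b])"
  by (auto simp: word_contents_def fun_eq_iff nth_append nat_less_iff)

lemma word_contents_snoc_numeral [simp]:
  "(word_contents w)(int (length w) := 2) = word_contents (w @ [True])"
  "(word_contents w)(int (length w) := Suc 0) = word_contents (w @ [False])"
  using word_contents_snoc[of w True] word_contents_snoc[of w False] by simp_all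

definition output_tape :: "bool list \<Rightarrow> tape" where
  "output_tape v = (word_contents v, int (length v))"

section \<open>Traversals of perfect trees\<close>

fun traversal_time :: "nat \<Rightarrow> nat" where
  "traversal_time 0 = 1"
| "traversal_time (Suc d) = 2 * traversal_time d + 3"

lemma traversal_time_eq: "traversal_time d + 3 = 2 ^ (d + 2)"
  by (induction d) auto

lemma step_output:
  "step reduction_machine (q, [(f, i), (g, j), output_tape v]) =
    (if q < 11 then case reduction_transition q [f i, g j, 0] of (q', acts) \<Rightarrow>
       (q', map2 act acts [(f, i), (g, j), output_tape v])
     else (q, [(f, i), (g, j), output_tape v]))"
  by (simp add: step_reduction_machine output_tape_def)

lemma act_output [simp]:
  "act (2, Move_Right) (output_tape v) = output_tape (v @ [True])"
  "act (Suc 0, Move_Right) (output_tape v) = output_tape (v @ [False])"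
  "act (bit_symbol b, Move_Right) (output_tape v) = output_tape (v @ [b])"
  "act (0, Stay) (output_tape v) = output_tape v"
  by (simp_all add: act_def output_tape_def)
    (metis fun_upd_triv word_contents_end)

lemma act_tape: "act (s, d) (g, j) = (g(j := s), j + head_offset d)"
  by (simp add: act_def)

text \<open>The marked cells from \<open>p\<close> on are the path to the first leaf, and the blank
  behind them is the leaf level. The stack is restored at the end, so it can serve for the second
  padding as well.\<close>

lemma writing_traversal:
  assumes "q = 4 \<or> q = 8" and "\<forall>i. p \<le> i \<and> i < p + int d \<longrightarrow> g i = 1" and "g (p + int d) = 0"
  shows "reaches (q, [(f, i), (g, p), output_tape v]) (traversal_time d)
    (q + 1, [(f, i), (g, p - 1), output_tape (v @ encode_tree (perfect d))])"
  using assms(2,3)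
proof (induction d arbitrary: g p v)
  case 0
  then show ?case
    using assms(1)
    by (auto intro!: reaches_step reaches_refl simp: step_output reduction_transition_def act_tape
        fun_upd_idem)
next
  case (Suc d)
  let ?e = "encode_tree (perfect d)"
  have p: "g p = 1" using Suc.prems by simp
  have IH: "reaches (q, [(f, i), (g', p + 1), output_tape v']) (traversal_time d)
      (q + 1, [(f, i), (g', p), output_tape (v' @ ?e)])"
    if "\<forall>i. p + 1 \<le> i \<and> i < p + 1 + int d \<longrightarrow> g' i = 1" and "g' (p + 1 + int d) = 0" for g' v'
    using Suc.IH[OF that] by simp
  have 1: "reaches (q, [(f, i), (g, p), output_tape v]) 1
      (q, [(f, i), (g, p + 1), output_tape (v @ [True])])"
    using assms(1) p
    by (auto intro!: reaches_step[of _ 0, simplified] reaches_refl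
        simp: step_output reduction_transition_def act_tape fun_upd_idem)
  have 2: "reaches (q, [(f, i), (g, p + 1), output_tape (v @ [True])]) (traversal_time d)
      (q + 1, [(f, i), (g, p), output_tape ((v @ [True]) @ ?e)])"
    by (rule IH) (use Suc.prems in \<open>auto simp: algebra_simps\<close>)
  have 3: "reaches (q + 1, [(f, i), (g, p), output_tape ((v @ [True]) @ ?e)]) 1
      (q, [(f, i), (g(p := 2), p + 1), output_tape ((v @ [True]) @ ?e)])"
    using assms(1) p
    by (auto intro!: reaches_step[of _ 0, simplified] reaches_refl
        simp: step_output reduction_transition_def act_tape fun_upd_idem)
  \<comment> \<open>The right subtree is traversed while cell \<open>p\<close> holds
    \<open>2\<close>; the induction generalizes over \<open>g\<close> for the sake of this
    call.\<close>
  have 4: "reaches (q, [(f, i), (g(p := 2), p + 1), output_tape ((v @ [True]) @ ?e)])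
      (traversal_time d)
      (q + 1, [(f, i), (g(p := 2), p), output_tape (((v @ [True]) @ ?e) @ ?e)])"
    by (rule IH) (use Suc.prems in \<open>auto simp: algebra_simps\<close>)
  have 5: "reaches (q + 1, [(f, i), (g(p := 2), p), output_tape (((v @ [True]) @ ?e) @ ?e)]) 1
      (q + 1, [(f, i), (g, p - 1), output_tape (((v @ [True]) @ ?e) @ ?e)])"
    using assms(1) p
    by (auto intro!: reaches_step[of _ 0, simplified] reaches_refl
        simp: step_output reduction_transition_def act_tape fun_upd_idem)
  have time: "1 + (traversal_time d + (1 + (traversal_time d + 1))) \<le> traversal_time (Suc d)"
    by simp
  from reaches_mono[OF
      reaches_trans[OF 1 reaches_trans[OF 2 reaches_trans[OF 3 reaches_trans[OF 4 5]]]] time]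
  show ?case by simp
qed

text \<open>Each of the \<open>2 ^ d\<close> leaves advances the input head by one cell;
  \<open>min\<close> accounts for the head waiting on the first blank after the input.\<close>

lemma counting_traversal:
  assumes "\<forall>i. p \<le> i \<and> i < p + int d \<longrightarrow> g i = 1" and "g (p + int d) = 0"
  shows "reaches (1, [(word_contents w, int (min (length w) n)), (g, p), output_tape v])
    (traversal_time d)
    (0, [(word_contents w, int (min (length w) (n + 2 ^ d))), (g, p - 1), output_tape v])"
  using assms
proof (induction d arbitrary: g p n)
  case 0
  show ?case
  proof (cases "n < length w")
    case True
    then have "min (length w) n = n" "min (length w) (n + 2 ^ 0) = Suc n" by simp_all
    with True 0 show ?thesis
      by (auto intro!: reaches_step reaches_refl simp: step_output reduction_transition_def act_tape
          fun_upd_idem word_contents_nth add.commute)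
  next
    case False
    with 0 show ?thesis
      by (auto intro!: reaches_step reaches_refl simp: step_output reduction_transition_def act_tape
          fun_upd_idem min_def)
  qed
next
  case (Suc d)
  let ?i = "\<lambda>n. (word_contents w, int (min (length w) n))"
  have p: "g p = 1" using Suc.prems by simp
  have IH: "reaches (1, [?i n', (g', p + 1), output_tape v]) (traversal_time d)
      (0, [?i (n' + 2 ^ d), (g', p), output_tape v])"
    if "\<forall>i. p + 1 \<le> i \<and> i < p + 1 + int d \<longrightarrow> g' i = 1" and "g' (p + 1 + int d) = 0" for g' n'
    using Suc.IH[OF that] by simp
  have 1: "reaches (1, [?i n, (g, p), output_tape v]) 1 (1, [?i n, (g, p + 1), output_tape v])"
    using p
    by (auto intro!: reaches_step[of _ 0, simplified] reaches_refl
        simp: step_output reduction_transition_def act_tape fun_upd_idem)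
  have 2: "reaches (1, [?i n, (g, p + 1), output_tape v]) (traversal_time d)
      (0, [?i (n + 2 ^ d), (g, p), output_tape v])"
    by (rule IH) (use Suc.prems in \<open>auto simp: algebra_simps\<close>)
  have 3: "reaches (0, [?i (n + 2 ^ d), (g, p), output_tape v]) 1
      (1, [?i (n + 2 ^ d), (g(p := 2), p + 1), output_tape v])"
    using p
    by (auto intro!: reaches_step[of _ 0, simplified] reaches_refl
        simp: step_output reduction_transition_def act_tape fun_upd_idem)
  have 4: "reaches (1, [?i (n + 2 ^ d), (g(p := 2), p + 1), output_tape v]) (traversal_time d)
      (0, [?i (n + 2 ^ d + 2 ^ d), (g(p := 2), p), output_tape v])"
    by (rule IH) (use Suc.prems in \<open>auto simp: algebra_simps\<close>)
  have 5: "reaches (0, [?i (n + 2 ^ d + 2 ^ d), (g(p := 2), p), output_tape v]) 1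
      (0, [?i (n + 2 ^ d + 2 ^ d), (g, p - 1), output_tape v])"
    using p
    by (auto intro!: reaches_step[of _ 0, simplified] reaches_refl
        simp: step_output reduction_transition_def act_tape fun_upd_idem)
  have time: "1 + (traversal_time d + (1 + (traversal_time d + 1))) \<le> traversal_time (Suc d)"
    by simp
  have n: "n + 2 ^ d + 2 ^ d = n + 2 ^ Suc d" by simp
  from reaches_mono[OF
      reaches_trans[OF 1 reaches_trans[OF 2 reaches_trans[OF 3 reaches_trans[OF 4 5]]]] time]
  show ?case unfolding n .
qed

text \<open>The stack grows to the left: a finished traversal leaves the head on the blank cell
  \<open>- int h\<close>, where the next root is marked, while cell \<open>1\<close> remains the
  leaf level.\<close>

definition stack :: "nat \<Rightarrow> int \<Rightarrow> nat" where
  "stack h i = (if - int h < i \<and> i \<le> 0 then 1 else 0)"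

lemma stack_push: "(stack h)(- int h := Suc 0) = stack (Suc h)"
  by (auto simp: stack_def fun_eq_iff)

lemma stack_0: "stack 0 = word_contents []"
  by (auto simp: stack_def word_contents_def fun_eq_iff)

text \<open>Before the padding height is reached, the leaves counted so far are fewer than the input
  symbols. The head is then still on a symbol, and state \<open>0\<close> starts another, higher
  traversal.\<close>

lemma counting_traversals:
  assumes "h \<le> padding_height (length w)"
  shows "reaches (initial_configuration reduction_machine w) (2 ^ (h + 3))
    (0, [(word_contents w, int (min (length w) (2 ^ Suc h - 2))), (stack h, - int h), output_tape []])"
  using assms
proof (induction h)
  case 0
  then show ?case
    by (simp add: initial_configuration_def numeral_2_eq_2 stack_0 output_tape_def reaches_refl)
next
  case (Suc h)
  define n :: nat where "n = 2 ^ Suc h - 2"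
  have n: "n < length w"
  proof -
    have "(2::nat) \<le> 2 ^ Suc h" by simp
    moreover have "2 ^ Suc h < length w + 2"
      using less_padding_height[of h "length w"] Suc.prems by simp
    ultimately show ?thesis unfolding n_def by linarith
  qed
  moreover have "stack h (- int h) = 0" by (simp add: stack_def)
  ultimately have 1: "reaches
      (0, [(word_contents w, int (min (length w) n)), (stack h, - int h), output_tape []]) 1
      (1, [(word_contents w, int (min (length w) n)), (stack (Suc h), - int h), output_tape []])"
    by (auto intro!: reaches_step[of _ 0, simplified] reaches_refl
        simp: step_output reduction_transition_def act_tape fun_upd_idem word_contents_nth
          stack_push min_def)
  have 2: "reaches
      (1, [(word_contents w, int (min (length w) n)), (stack (Suc h), - int h), output_tape []])
      (traversal_time (Suc h))
      (0, [(word_contents w, int (min (length w) (n + 2 ^ Suc h))),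
        (stack (Suc h), - int h - 1), output_tape []])"
    by (rule counting_traversal) (auto simp: stack_def)
  have n': "n + 2 ^ Suc h = 2 ^ Suc (Suc h) - 2" by (simp add: n_def)
  have h: "- int h - 1 = - int (Suc h)" by simp
  \<comment> \<open>The new traversal takes \<open>2 ^ (h + 3) - 3\<close> steps, so each round at
    most doubles the bound.\<close>
  have time: "2 ^ (h + 3) + (1 + traversal_time (Suc h)) \<le> 2 ^ (Suc h + 3)"
    using traversal_time_eq[of "Suc h"] by (simp add: eval_nat_numeral)
  have "h \<le> padding_height (length w)" using Suc.prems by simp
  from reaches_mono[OF reaches_trans[OF Suc.IH[OF this, folded n_def] reaches_trans[OF 1 2]] time]
  show ?case unfolding n' h .
qed

text \<open>The blank in cell \<open>-1\<close> stops the rewinding; \<open>i + 1\<close> includes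
  the step back to cell \<open>0\<close>.\<close>

lemma rewinding:
  assumes "i \<le> length w"
  shows "reaches (2, [(word_contents w, int i - 1), (g, j), output_tape v]) (i + 1)
    (3, [(word_contents w, 0), (g, j), output_tape v])"
  using assms
proof (induction i)
  case 0
  show ?case
    by (auto intro!: reaches_step reaches_refl simp: step_output reduction_transition_def act_tape
        fun_upd_idem)
next
  case (Suc i)
  then have "reaches
      (step reduction_machine (2, [(word_contents w, int (Suc i) - 1), (g, j), output_tape v]))
      (i + 1) (3, [(word_contents w, 0), (g, j), output_tape v])"
    by (simp add: step_output reduction_transition_def act_tape fun_upd_idem word_contents_nth)
  from reaches_step[OF this] show ?case by simp
qed

lemma counting_phase:
  fixes w :: "bool list"
  defines "h \<equiv> padding_height (length w)"
  shows "reaches (initial_configuration reduction_machine w) (9 * length w + 10)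
    (3, [(word_contents w, 0), (stack h, 1 - int h), output_tape []])"
proof -
  \<comment> \<open>By the choice of \<open>h\<close> the whole input has been consumed, so state
    \<open>0\<close> sees a blank and passes to rewinding.\<close>
  have min: "min (length w) (2 ^ Suc h - 2) = length w"
    using padding_height[of "length w"] unfolding h_def by linarith
  have 1: "reaches (initial_configuration reduction_machine w) (2 ^ (h + 3))
      (0, [(word_contents w, int (length w)), (stack h, - int h), output_tape []])"
    using counting_traversals[of h w] unfolding min by (simp add: h_def)
  have 2: "reaches (0, [(word_contents w, int (length w)), (stack h, - int h), output_tape []]) 1
      (2, [(word_contents w, int (length w) - 1), (stack h, 1 - int h), output_tape []])"
    by (auto intro!: reaches_step[of _ 0, simplified] reaches_refl
        simp: step_output reduction_transition_def act_tape fun_upd_idem stack_def)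
  have "2 ^ (h + 3) + (1 + (length w + 1)) \<le> 9 * length w + 10"
    using power_padding_height_le[of "length w"] by (simp add: h_def power_add)
  then show ?thesis
    using reaches_mono[OF reaches_trans[OF 1 reaches_trans[OF 2 rewinding]]] by simp
qed

lemma writing_phase:
  fixes n :: nat
  assumes "q = 3 \<or> q = 7"
  defines "h \<equiv> padding_height n"
  shows "reaches (q, [(f, i), (stack h, 1 - int h), output_tape v]) (4 * n + 6)
    (q + 3, [(f, i), (stack h, 1 - int h), output_tape (v @ padding n)])"
proof -
  let ?v = "(v @ [True]) @ encode_tree (perfect h)"
  have 1: "reaches (q, [(f, i), (stack h, 1 - int h), output_tape v]) 1
      (q + 1, [(f, i), (stack h, 1 - int h), output_tape (v @ [True])])"
    using assms(1)
    by (auto intro!: reaches_step[of _ 0, simplified] reaches_refl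
        simp: step_output reduction_transition_def act_tape fun_upd_idem)
  have 2: "reaches (q + 1, [(f, i), (stack h, 1 - int h), output_tape (v @ [True])])
      (traversal_time h) (q + 1 + 1, [(f, i), (stack h, 1 - int h - 1), output_tape ?v])"
    using assms(1) by (intro writing_traversal) (auto simp: stack_def)
  have 3: "reaches (q + 1 + 1, [(f, i), (stack h, 1 - int h - 1), output_tape ?v]) 1
      (q + 3, [(f, i), (stack h, 1 - int h), output_tape ?v])"
    using assms(1)
    by (auto intro!: reaches_step[of _ 0, simplified] reaches_refl
        simp: step_output reduction_transition_def act_tape fun_upd_idem stack_def)
  have "1 + (traversal_time h + 1) \<le> 4 * n + 6"
    using traversal_time_eq[of h] power_padding_height_le[of n] by (simp add: h_def power_add)
  then show ?thesis
    using reaches_mono[OF reaches_trans[OF 1 reaches_trans[OF 2 3]]]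
    by (simp add: padding_def h_def)
qed

section \<open>Copying of the input word\<close>

lemma word_contents_append_Cons [simp]:
  "word_contents (x @ b # u) (int (length x)) = bit_symbol b"
  by (simp add: word_contents_nth)

text \<open>The blanks to the left of cell \<open>j\<close> act as a unary counter, and the nonblank
  cell \<open>j\<close> itself signals \<open>c = 0\<close>. The stack contents stay intact.\<close>

lemma copying_trees:
  assumes "split_trees c u = Some (y, r)" and "g j \<noteq> 0" and "\<forall>i<j. g i = 0"
  shows "reaches (6, [(word_contents (x @ u), int (length x)), (g, j - int c), output_tape v])
    (length u) (7, [(word_contents (x @ u), int (length (x @ y))), (g, j), output_tape (v @ y)])"
  using assms(1)
proof (induction c u arbitrary: x v y rule: split_trees.induct)
  case (2 c u)
  then obtain y' where y': "y = True # y'" "split_trees (Suc c) u = Some (y', r)" by auto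
  from "2.IH"[OF y'(2), of "x @ [True]" "v @ [True]"] show ?case
    by (auto intro!: reaches_step simp: step_output reduction_transition_def act_tape
        fun_upd_idem y'(1) algebra_simps)
next
  case (3 u)
  then show ?case
    using assms(2)
    by (auto intro!: reaches_step reaches_refl simp: step_output reduction_transition_def act_tape
        fun_upd_idem)
next
  case (4 c u)
  then obtain y' where y': "y = False # y'" "split_trees c u = Some (y', r)" by auto
  from "4.IH"[OF y'(2), of "x @ [False]" "v @ [False]"] assms(3) show ?case
    by (auto intro!: reaches_step simp: step_output reduction_transition_def act_tape
        fun_upd_idem y'(1) algebra_simps)
qed simp

text \<open>If no first tree is completed, the input runs out in state \<open>6\<close>. The machine
  then halts with everything copied, which matches the \<open>None\<close> case of
  \<open>reduction\<close>.\<close>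

lemma copying_trees_failure:
  assumes "split_trees c u = None" and "\<forall>i<j. g i = 0"
  shows "\<exists>k. reaches (6, [(word_contents (x @ u), int (length x)), (g, j - int c), output_tape v])
    (length u + 1) (11, [(word_contents (x @ u), int (length (x @ u))), (g, k), output_tape (v @ u)])"
  using assms(1)
proof (induction c u arbitrary: x v rule: split_trees.induct)
  case (1 c)
  show ?case
    by (intro exI[of _ "j - int c"])
      (auto intro!: reaches_step[of _ 0, simplified] reaches_refl
        simp: step_output reduction_transition_def act_tape fun_upd_idem)
next
  case (2 c u)
  have 1: "reaches (6, [(word_contents (x @ True # u), int (length x)), (g, j - int c), output_tape v]) 1
      (6, [(word_contents ((x @ [True]) @ u), int (length (x @ [True]))), (g, j - int (Suc c)),
        output_tape (v @ [True])])"
    by (auto intro!: reaches_step[of _ 0, simplified] reaches_refl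
        simp: step_output reduction_transition_def act_tape fun_upd_idem algebra_simps)
  obtain k where
    "reaches (6, [(word_contents ((x @ [True]) @ u), int (length (x @ [True]))),
        (g, j - int (Suc c)), output_tape (v @ [True])])
      (length u + 1) (11, [(word_contents ((x @ [True]) @ u), int (length ((x @ [True]) @ u))), (g, k),
        output_tape ((v @ [True]) @ u)])"
    using "2.IH"[of "x @ [True]" "v @ [True]"] "2.prems" by auto
  from reaches_trans[OF 1 this] show ?case
    by (intro exI[of _ k]) simp
next
  case (4 c u)
  have 1: "reaches
      (6, [(word_contents (x @ False # u), int (length x)), (g, j - int (Suc c)), output_tape v]) 1
      (6, [(word_contents ((x @ [False]) @ u), int (length (x @ [False]))), (g, j - int c),
        output_tape (v @ [False])])"
    using assms(2)
    by (auto intro!: reaches_step[of _ 0, simplified] reaches_refl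
        simp: step_output reduction_transition_def act_tape fun_upd_idem algebra_simps)
  obtain k where
    "reaches (6, [(word_contents ((x @ [False]) @ u), int (length (x @ [False]))),
        (g, j - int c), output_tape (v @ [False])])
      (length u + 1) (11, [(word_contents ((x @ [False]) @ u), int (length ((x @ [False]) @ u))), (g, k),
        output_tape ((v @ [False]) @ u)])"
    using "4.IH"[of "x @ [False]" "v @ [False]"] "4.prems" by auto
  from reaches_trans[OF 1 this] show ?case
    by (intro exI[of _ k]) simp
qed simp

lemma copying_rest:
  "reaches (10, [(word_contents (x @ u), int (length x)), (g, j), output_tape v])
    (length u + 1) (11, [(word_contents (x @ u), int (length (x @ u))), (g, j), output_tape (v @ u)])"
proof (induction u arbitrary: x v)
  case Nil
  show ?case
    by (auto intro!: reaches_step[of _ 0, simplified] reaches_refl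
        simp: step_output reduction_transition_def act_tape fun_upd_idem)
next
  case (Cons b u)
  have "reaches (10, [(word_contents (x @ b # u), int (length x)), (g, j), output_tape v]) 1
      (10, [(word_contents ((x @ [b]) @ u), int (length (x @ [b]))), (g, j), output_tape (v @ [b])])"
    by (auto intro!: reaches_step[of _ 0, simplified] reaches_refl
        simp: step_output reduction_transition_def Let_def act_tape fun_upd_idem algebra_simps)
  from reaches_trans[OF this Cons.IH] show ?case by simp
qed

lemma reduction_machine_correct:
  "\<exists>s t. reaches (initial_configuration reduction_machine w) (19 * length w + 30)
    (11, [s, t, output_tape (reduction w)])"
proof -
  let ?h = "padding_height (length w)" and ?v = "padding (length w)"
  let ?j = "1 - int ?h"
  have 1: "reaches (initial_configuration reduction_machine w) (13 * length w + 16)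
      (6, [(word_contents w, 0), (stack ?h, ?j), output_tape ?v])"
    using reaches_trans[OF counting_phase
        writing_phase[where q = 3 and n = "length w" and f = "word_contents w" and i = 0 and v = "[]"]]
    by simp
  have below: "\<forall>i<?j. stack ?h i = 0" by (simp add: stack_def)
  show ?thesis
  proof (cases "split_trees 0 w")
    case None
    obtain k where
      "reaches (6, [(word_contents w, 0), (stack ?h, ?j), output_tape ?v]) (length w + 1)
        (11, [(word_contents w, int (length w)), (stack ?h, k), output_tape (?v @ w)])"
      using copying_trees_failure[OF None below, of "[]" ?v] by auto
    with 1 have "reaches (initial_configuration reduction_machine w)
        ((13 * length w + 16) + (length w + 1))
        (11, [(word_contents w, int (length w)), (stack ?h, k), output_tape (?v @ w)])"
      by (rule reaches_trans)
    then show ?thesis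
      by (auto simp: reduction_def None intro!: exI elim!: reaches_mono)
  next
    case (Some p)
    then obtain y u where p: "split_trees 0 w = Some (y, u)" by (cases p) auto
    then have w: "w = y @ u" and "w \<noteq> []" using split_trees_SomeD by fastforce+
    \<comment> \<open>Height \<open>0\<close> would force \<open>w\<close> to be empty. A positive
      height makes \<open>?j\<close> a marked cell, as the counter of the copying state
      requires.\<close>
    then have "?h \<noteq> 0"
      using padding_height[of "length w"] by (cases ?h) auto
    then have "stack ?h ?j \<noteq> 0" by (simp add: stack_def)
    from copying_trees[OF p this below, of "[]"]
    have 2: "reaches (6, [(word_contents w, 0), (stack ?h, ?j), output_tape ?v]) (length w)
        (7, [(word_contents w, int (length y)), (stack ?h, ?j), output_tape (?v @ y)])"
      by simp
    have 3: "reaches (7, [(word_contents w, int (length y)), (stack ?h, ?j), output_tape (?v @ y)])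
        (4 * length w + 6)
        (10, [(word_contents w, int (length y)), (stack ?h, ?j), output_tape ((?v @ y) @ ?v)])"
      using writing_phase[where q = 7 and n = "length w" and f = "word_contents w"
          and i = "int (length y)" and v = "?v @ y"]
      by simp
    have 4: "reaches
        (10, [(word_contents w, int (length y)), (stack ?h, ?j), output_tape ((?v @ y) @ ?v)])
        (length u + 1) (11, [(word_contents w, int (length w)), (stack ?h, ?j),
          output_tape (((?v @ y) @ ?v) @ u)])"
      using copying_rest[where x = y and u = u and g = "stack ?h" and j = ?j and v = "(?v @ y) @ ?v",
          folded w]
      by simp
    have "length u \<le> length w" using w by simp
    then have time: "(13 * length w + 16) + (length w + ((4 * length w + 6) + (length u + 1)))
        \<le> 19 * length w + 30"
      by simp
    have "reduction w = ((?v @ y) @ ?v) @ u" by (simp add: reduction_def p)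
    with reaches_mono[OF reaches_trans[OF 1 reaches_trans[OF 2 reaches_trans[OF 3 4]]] time]
    show ?thesis by (intro exI) (simp only:)
  qed
qed

lemma polynomial_time_computable_reduction: "polynomial_time_computable reduction"
  unfolding polynomial_time_computable_def
proof (intro exI[of _ reduction_machine] exI[of _ "[:30, 19:]"] conjI allI wf_reduction_machine)
  fix w
  obtain s t n where "n \<le> 19 * length w + 30"
    "(step reduction_machine ^^ n) (initial_configuration reduction_machine w) =
      (11, [s, t, output_tape (reduction w)])"
    using reduction_machine_correct[of w] by (auto simp: reaches_def)
  then show "\<exists>n \<le> poly [:30, 19:] (length w).
      halts_with_output reduction_machine
        ((step reduction_machine ^^ n) (initial_configuration reduction_machine w)) (reduction w)"
    by (intro exI[of _ n]) (simp add: halts_with_output_def output_tape_def)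
qed

theorem theorem1:
  shows "polynomial_time_many_one_reducible RotDist RotDist\<^sub>R"
  unfolding polynomial_time_many_one_reducible_def
  using polynomial_time_computable_reduction reduction_correct by blast

end
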